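(* Let $G$ be a (simple, connected, undirected) graph that contains no cycle of length 3 and no cycle of length 4. Then the discrete homotopy group $A_n(G)$ is trivial for every $n\geq 2$.
   Context: All graphs are simple, connected and undirected. For vertices $u,v$ write $u\simeq v$ if $u=v$ or $u,v$ are adjacent. A graph map $f:G_1\to G_2$ is a function between vertex sets with $f(u)\simeq f(v)$ whenever $u\simeq v$. Let $\mathbb{Z}$ denote the graph on the integers with $i,j$ adjacent iff $|i-j|=1$, $I_m$ its induced subgraph on $\{0,\dots,m\}$, and $\times$ the Cartesian product of graphs; so $\mathbb{Z}^n$ has vertex set $\mathbb{Z}^n$ with two vertices adjacent iff they differ by $1$ in exactly one coordinate. For $r\geq 0$ let $\mathbb{Z}^n_{\geq r}=\{x\in\mathbb{Z}^n: |x_i|\geq r \text{ for some } i\}$. Fix a vertex $v_0\in G$. A based map $f:(\mathbb{Z}^n,\partial\mathbb{Z}^n)\to(G,v_0)$ is a graph map $f:\mathbb{Z}^n\to G$ such that for some $r\geq0$, $f(x)=v_0$ for all $x\in\mathbb{Z}^n_{\geq r}$; the least such $r$ is the radius of $f$. Two based maps $f,g$ are based homotopic if for some $m\geq 0$ there is a graph map $h:\mathbb{Z}^n\times I_m\to G$ with $h(-,0)=f$, $h(-,m)=g$ and each $h(-,i)$ a based map. $A_n(G)$ is the set of based homotopy classes $[f]$, with product $[f]\cdot[g]=[p]$ where, for $f,g$ of radii $r_f,r_g$, $p(x)=f(x)$ if $x_1\leq r_f$ and $p(x)=g(x_1-(r_f+r_g),x_2,\dots,x_n)$ if $x_1>r_f$;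 the identity is the class of the constant map to $v_0$. This is a group, and for connected $G$ it does not depend (up to isomorphism) on $v_0$. "Trivial" means it has one element. *)

theory Defs
  imports "HOL-Algebra.Elementary_Groups" "Graph_Theory.Graph_Theory"
begin

text \<open>
  Simple undirected graphs, possibly infinite, are symmetric loop-free pair digraphs
  (\<^locale>\<open>pair_bidirected_digraph\<close>), every edge being represented by its two arcs.
\<close>

definition adj_or_eq :: "'a pair_pre_digraph \<Rightarrow> 'a \<Rightarrow> 'a \<Rightarrow> bool" where
  "adj_or_eq G u v \<longleftrightarrow> u = v \<or> (u, v) \<in> parcs G"

definition graph_map :: "'a pair_pre_digraph \<Rightarrow> 'b pair_pre_digraph \<Rightarrow> ('a \<Rightarrow> 'b) \<Rightarrow> bool" where
  "graph_map G H f \<longleftrightarrow> f \<in> Pi (pverts G) (\<lambda>_. pverts H) \<and>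
     (\<forall>u \<in> pverts G. \<forall>v \<in> pverts G. adj_or_eq G u v \<longrightarrow> adj_or_eq H (f u) (f v))"

definition cartesian_product ::
    "'a pair_pre_digraph \<Rightarrow> 'b pair_pre_digraph \<Rightarrow> ('a \<times> 'b) pair_pre_digraph" where
  "cartesian_product G H = \<lparr> pverts = pverts G \<times> pverts H,
     parcs = {((u, u'), (v, v')).
       (u = v \<and> u \<in> pverts G \<and> (u', v') \<in> parcs H) \<or>
       ((u, v) \<in> parcs G \<and> u' = v' \<and> u' \<in> pverts H)} \<rparr>"

definition int_graph :: "int pair_pre_digraph" where
  "int_graph = \<lparr> pverts = UNIV, parcs = {(i, j). \<bar>i - j\<bar> = 1} \<rparr>"

definition interval_graph :: "nat \<Rightarrow> int pair_pre_digraph" where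
  "interval_graph m = \<lparr> pverts = {0..int m}, parcs = Restr (parcs int_graph) {0..int m} \<rparr>"

text \<open>
  A point of the \<open>n\<close>-dimensional lattice is a function on the coordinate set \<open>{1..n}\<close>, extended by
  \<^const>\<open>undefined\<close> outside of it.
\<close>

definition lattice_graph :: "nat \<Rightarrow> (nat \<Rightarrow> int) pair_pre_digraph" where
  "lattice_graph n = \<lparr> pverts = PiE {1..n} (\<lambda>_. UNIV),
     parcs = {(x, y). x \<in> PiE {1..n} (\<lambda>_. UNIV) \<and> y \<in> PiE {1..n} (\<lambda>_. UNIV) \<and>
       (\<exists>i \<in> {1..n}. \<bar>x i - y i\<bar> = 1 \<and> (\<forall>j \<in> {1..n} - {i}. x j = y j))} \<rparr>"

definition lattice_beyond :: "nat \<Rightarrow> nat \<Rightarrow> (nat \<Rightarrow> int) set" where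
  "lattice_beyond n r = {x \<in> pverts (lattice_graph n). \<exists>i \<in> {1..n}. \<bar>x i\<bar> \<ge> int r}"

text \<open>
  Based maps are normalised to be \<^const>\<open>undefined\<close> off the lattice, so that equality of
  based maps is equality of functions on the lattice.
\<close>

definition based_maps :: "nat \<Rightarrow> 'a pair_pre_digraph \<Rightarrow> 'a \<Rightarrow> ((nat \<Rightarrow> int) \<Rightarrow> 'a) set" where
  "based_maps n G v0 = {f \<in> extensional (pverts (lattice_graph n)).
     graph_map (lattice_graph n) G f \<and> (\<exists>r. \<forall>x \<in> lattice_beyond n r. f x = v0)}"

definition radius :: "nat \<Rightarrow> 'a \<Rightarrow> ((nat \<Rightarrow> int) \<Rightarrow> 'a) \<Rightarrow> nat" where
  "radius n v0 f = (LEAST r. \<forall>x \<in> lattice_beyond n r. f x = v0)"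

definition slice :: "nat \<Rightarrow> ((nat \<Rightarrow> int) \<times> int \<Rightarrow> 'a) \<Rightarrow> int \<Rightarrow> (nat \<Rightarrow> int) \<Rightarrow> 'a" where
  "slice n h i = (\<lambda>x \<in> pverts (lattice_graph n). h (x, i))"

definition based_homotopy ::
    "nat \<Rightarrow> 'a pair_pre_digraph \<Rightarrow> 'a \<Rightarrow> (((nat \<Rightarrow> int) \<Rightarrow> 'a) \<times> ((nat \<Rightarrow> int) \<Rightarrow> 'a)) set" where
  "based_homotopy n G v0 = {(f, g). f \<in> based_maps n G v0 \<and> g \<in> based_maps n G v0 \<and>
     (\<exists>m h. graph_map (cartesian_product (lattice_graph n) (interval_graph m)) G h \<and>
       slice n h 0 = f \<and> slice n h (int m) = g \<and>
       (\<forall>i \<in> pverts (interval_graph m). slice n h i \<in> based_maps n G v0))}"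

definition map_concat ::
    "nat \<Rightarrow> 'a \<Rightarrow> ((nat \<Rightarrow> int) \<Rightarrow> 'a) \<Rightarrow> ((nat \<Rightarrow> int) \<Rightarrow> 'a) \<Rightarrow> (nat \<Rightarrow> int) \<Rightarrow> 'a" where
  "map_concat n v0 f g = (\<lambda>x \<in> pverts (lattice_graph n).
     if x 1 \<le> int (radius n v0 f) then f x
     else g (x(1 := x 1 - (int (radius n v0 f) + int (radius n v0 g)))))"

text \<open>
  The product of two classes is the union of the classes of \<^term>\<open>map_concat n v0 f g\<close> over all
  representatives \<open>f\<close>, \<open>g\<close>; as the product does not depend on them, this is a single class.
  The definition is meant for \<open>n \<ge> 1\<close>, as concatenation takes place along the first coordinate.
\<close>

definition discrete_homotopy_group ::
    "nat \<Rightarrow> 'a pair_pre_digraph \<Rightarrow> 'a \<Rightarrow> ((nat \<Rightarrow> int) \<Rightarrow> 'a) set monoid" where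
  "discrete_homotopy_group n G v0 = \<lparr>
     carrier = based_maps n G v0 // based_homotopy n G v0,
     monoid.mult = (\<lambda>X Y. \<Union>f \<in> X. \<Union>g \<in> Y. based_homotopy n G v0 `` {map_concat n v0 f g}),
     monoid.one = based_homotopy n G v0 `` {\<lambda>x \<in> pverts (lattice_graph n). v0} \<rparr>"

end

theory Submission
  imports Defs
begin

text \<open>
  In a graph without cycles of length 3 and 4 every square of the lattice maps to a closed walk that
  is trivial up to backtracking, so a based map lifts to the tree of reduced walks (the universal
  cover). For \<open>n \<ge> 2\<close> the lattice stays connected outside a large cube, so the lift is constant
  there. Moving every vertex of the tree towards the root, one step at a time, then contracts
  the lift, and the final vertices of the walks give a homotopy from the based map to the constant
  one.

  A walk is stored with its final vertex first, so that the parent of a walk is its tail.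
\<close>

section \<open>Reduced walks\<close>

locale no_short_cycles = pair_bidirected_digraph G for G :: "'a pair_pre_digraph" +
  assumes no_3_cycle: "\<not> (\<exists>p. cycle p \<and> length p = 3)"
    and no_4_cycle: "\<not> (\<exists>p. cycle p \<and> length p = 4)"
begin

abbreviation adj_eq :: "'a \<Rightarrow> 'a \<Rightarrow> bool" (infix "\<simeq>" 50) where
  "u \<simeq> v \<equiv> adj_or_eq G u v"

lemma adj_eq_refl [simp]: "u \<simeq> u"
  by (simp add: adj_or_eq_def)

lemma arc_sym: "(u, v) \<in> parcs G \<Longrightarrow> (v, u) \<in> parcs G"
  using pair_sym_arcs by (auto simp: symmetric_def sym_def)

lemma adj_eq_sym: "u \<simeq> v \<Longrightarrow> v \<simeq> u"
  by (auto simp: adj_or_eq_def arc_sym)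

lemma no_loop [simp]: "(u, u) \<notin> parcs G"
  using pair_no_loops by force

section \<open>Degenerate triangles and squares in the graph\<close>

lemma triangle_degenerate:
  assumes "a \<simeq> b" "b \<simeq> c" "c \<simeq> a"
  shows "a = b \<or> b = c \<or> c = a"
proof (rule ccontr)
  assume neq: "\<not> ?thesis"
  with assms have "cycle [(a, b), (b, c), (c, a)]"
    by (auto simp: adj_or_eq_def cycle_def awalk_def intro: in_arcsD1)
  then show False using no_3_cycle by (metis length_Cons list.size(3) numeral_3_eq_3)
qed

text \<open>Four distinct vertices would form a cycle of length 4. The diagonal cases
  \<open>a = c\<close> and \<open>b = d\<close> are squares that backtrack; they are what allows
  homotopies to be lifted.\<close>

lemma square_degenerate:
  assumes "a \<simeq> b" "b \<simeq> c" "c \<simeq> d" "d \<simeq> a"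
  shows "a = b \<or> b = c \<or> c = d \<or> d = a \<or> a = c \<or> b = d"
proof (rule ccontr)
  assume neq: "\<not> ?thesis"
  with assms have "cycle [(a, b), (b, c), (c, d), (d, a)]"
    by (auto simp: adj_or_eq_def cycle_def awalk_def intro: in_arcsD1)
  moreover have "length [(a, b), (b, c), (c, d), (d, a)] = 4" by simp
  ultimately show False using no_4_cycle by blast
qed

text \<open>The condition \<open>hd w \<noteq> u\<close> forbids backtracking. The start vertex is
  left free, so these walks are the nodes of a forest with one tree per start vertex, rooted at the
  singleton.\<close>

fun reduced_walk :: "'a list \<Rightarrow> bool" where
  "reduced_walk [] \<longleftrightarrow> False"
| "reduced_walk [v] \<longleftrightarrow> v \<in> pverts G"
| "reduced_walk (u # v # w) \<longleftrightarrow>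
     (u, v) \<in> parcs G \<and> (w = [] \<or> hd w \<noteq> u) \<and> reduced_walk (v # w)"

text \<open>On reduced walks this is the relation \<open>\<simeq>\<close> of the forest,
  \<open>tl\<close> being the parent; the tail \<open>[]\<close> of a root is not a reduced
  walk.\<close>

definition tree_adj_eq :: "'a list \<Rightarrow> 'a list \<Rightarrow> bool" where
  "tree_adj_eq w w' \<longleftrightarrow> w = w' \<or> w = tl w' \<or> w' = tl w"

lemma tree_adj_eq_refl [simp]: "tree_adj_eq w w"
  by (simp add: tree_adj_eq_def)

lemma tree_adj_eq_sym: "tree_adj_eq w w' \<Longrightarrow> tree_adj_eq w' w"
  by (auto simp: tree_adj_eq_def)

lemma reduced_walk_not_Nil: "reduced_walk w \<Longrightarrow> w \<noteq> []"
  by auto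

lemma reduced_walk_hd: "reduced_walk w \<Longrightarrow> hd w \<in> pverts G"
  by (cases w rule: reduced_walk.cases) (auto intro: in_arcsD1)

lemma reduced_walk_tl: "reduced_walk w \<Longrightarrow> tl w \<noteq> [] \<Longrightarrow> reduced_walk (tl w)"
  by (cases w rule: reduced_walk.cases) auto

lemma reduced_walk_ConsD: "reduced_walk (u # w) \<Longrightarrow> w \<noteq> [] \<Longrightarrow> (u, hd w) \<in> parcs G"
  by (cases w) auto

lemma tree_adj_eq_cases [consumes 3, case_names eq parent child]:
  assumes "tree_adj_eq w w'" "reduced_walk w" "reduced_walk w'"
  obtains "w = w'" | u where "w' = u # w" | u where "w = u # w'"
  using assms reduced_walk_not_Nil[of w] reduced_walk_not_Nil[of w']
  unfolding tree_adj_eq_def by (metis list.collapse)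

lemma tree_adj_eq_hd:
  assumes "tree_adj_eq w w'" "reduced_walk w" "reduced_walk w'"
  shows "hd w \<simeq> hd w'"
  using assms(1-3)
proof (cases rule: tree_adj_eq_cases)
  case (parent u)
  with assms show ?thesis
    by (auto simp: adj_or_eq_def intro!: arc_sym[OF reduced_walk_ConsD] reduced_walk_not_Nil)
next
  case (child u)
  with assms show ?thesis
    by (auto simp: adj_or_eq_def intro!: reduced_walk_ConsD reduced_walk_not_Nil)
qed simp

text \<open>A proper edge of the forest lies over an arc of \<open>G\<close>, and \<open>G\<close>
  has no loops. Hence a lift cannot change where the map below it is constant.\<close>

lemma tree_adj_eq_same_hd:
  assumes "tree_adj_eq w w'" "reduced_walk w" "reduced_walk w'" "hd w = hd w'"
  shows "w = w'"
  using assms(1-3)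
proof (cases rule: tree_adj_eq_cases)
  case (parent u)
  with assms reduced_walk_ConsD[of u w] show ?thesis by (cases w) auto
next
  case (child u)
  with assms reduced_walk_ConsD[of u w'] show ?thesis by (cases w') auto
qed

text \<open>Path lifting for a single step: stay, backtrack to the parent, or append. Backtracking
  where possible keeps the walk reduced.\<close>

definition extend :: "'a list \<Rightarrow> 'a \<Rightarrow> 'a list" where
  "extend w v = (if hd w = v then w else if tl w \<noteq> [] \<and> hd (tl w) = v then tl w else v # w)"

lemma hd_extend [simp]: "hd (extend w v) = v"
  by (auto simp: extend_def)

lemma last_extend: "w \<noteq> [] \<Longrightarrow> last (extend w v) = last w"
  by (auto simp: extend_def last_tl)

lemma length_extend: "length (extend w v) \<le> Suc (length w)"
  by (auto simp: extend_def)

lemma tree_adj_eq_extend: "tree_adj_eq w (extend w v)"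
  by (auto simp: extend_def tree_adj_eq_def)

lemma reduced_walk_extend:
  assumes "reduced_walk w" "hd w \<simeq> v"
  shows "reduced_walk (extend w v)"
proof (cases w rule: reduced_walk.cases)
  case (2 u)
  with assms show ?thesis
    by (auto simp: extend_def adj_or_eq_def arc_sym in_arcsD2)
qed (use assms in \<open>auto simp: extend_def adj_or_eq_def arc_sym\<close>)

text \<open>The lifting of a square: the edge from \<open>hd w\<close> to \<open>b\<close> is moved
  to the edge from \<open>a'\<close> to \<open>b'\<close>. Without 3- and 4-cycles one of the two
  walks merely stays or moves across the edge itself, and this keeps the extensions
  adjacent.\<close>

lemma tree_adj_eq_extend_child:
  assumes "reduced_walk (b # w)" "w \<noteq> []" "hd w \<simeq> a'" "b \<simeq> b'" "a' \<simeq> b'"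
  shows "tree_adj_eq (extend w a') (extend (b # w) b')"
proof -
  define a where "a = hd w"
  have ab: "(b, a) \<in> parcs G" "a \<noteq> b"
    using assms(1,2) reduced_walk_ConsD[of b w] by (auto simp: a_def)
  consider "a' = a" | "a' = b" | "a' \<noteq> a" "a' \<noteq> b" by blast
  then show ?thesis
  proof cases
    case 1
    with ab assms have "b' = a \<or> b' = b"
      using triangle_degenerate[of b b' a] by (auto simp: adj_or_eq_def arc_sym a_def)
    then show ?thesis
      using 1 assms(2) ab by (auto simp: extend_def tree_adj_eq_def a_def)
  next
    case 2
    \<comment> \<open>Reducedness of \<open>b # w\<close> excludes that stepping from
      \<open>w\<close> to \<open>b\<close> backtracks.\<close>
    with assms(1,2) ab have "extend w a' = b # w"
      by (cases w rule: reduced_walk.cases) (auto simp: extend_def a_def)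
    then show ?thesis by (simp add: tree_adj_eq_extend)
  next
    case 3
    have "a \<simeq> a'" "b \<simeq> a" using assms ab by (auto simp: adj_or_eq_def a_def)
    \<comment> \<open>Either of \<open>a' = b'\<close> and \<open>b' = b\<close> would make
      \<open>a\<close>, \<open>a'\<close>, \<open>b\<close> a triangle, so the square can only
      degenerate through the diagonal \<open>b' = a\<close>: the longer walk backtracks to
      \<open>w\<close>.\<close>
    with 3 ab assms have "b' = a"
      using triangle_degenerate[of a a' b] square_degenerate[of a a' b' b]
      by (auto dest: adj_eq_sym)
    then have "extend (b # w) b' = w"
      using ab assms(2) by (auto simp: extend_def a_def)
    then show ?thesis by (metis tree_adj_eq_extend tree_adj_eq_sym)
  qed
qed

lemma tree_adj_eq_extend_extend:
  assumes "tree_adj_eq w w'" "reduced_walk w" "reduced_walk w'"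
    and "hd w \<simeq> v" "hd w' \<simeq> v'" "v \<simeq> v'"
  shows "tree_adj_eq (extend w v) (extend w' v')"
  using assms(1-3)
proof (cases rule: tree_adj_eq_cases)
  case eq
  consider "v = v'" | "v = hd w" | "v' = hd w"
    using triangle_degenerate[of "hd w" v v'] assms eq by (auto dest: adj_eq_sym)
  then show ?thesis
  proof cases
    case 2
    then show ?thesis using eq tree_adj_eq_extend[of w v'] by (simp add: extend_def)
  next
    case 3
    then show ?thesis
      using eq tree_adj_eq_sym[OF tree_adj_eq_extend[of w v]] by (simp add: extend_def)
  qed (simp add: eq)
next
  case (parent u)
  with assms show ?thesis by (auto intro!: tree_adj_eq_extend_child)
next
  case (child u)
  with assms show ?thesis
    by (auto intro!: tree_adj_eq_sym[OF tree_adj_eq_extend_child] dest: adj_eq_sym)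
qed

section \<open>Moving walks towards the root\<close>

definition shrink :: "'a list \<Rightarrow> 'a list" where
  "shrink w = (if tl w = [] then w else tl w)"

lemma reduced_walk_shrink: "reduced_walk w \<Longrightarrow> reduced_walk (shrink w)"
  by (simp add: shrink_def reduced_walk_tl)

lemma reduced_walk_funpow_shrink: "reduced_walk w \<Longrightarrow> reduced_walk ((shrink ^^ i) w)"
  by (induction i) (auto simp: reduced_walk_shrink)

lemma tree_adj_eq_shrink: "tree_adj_eq w (shrink w)"
  by (simp add: shrink_def tree_adj_eq_def)

lemma tree_adj_eq_shrink_shrink:
  assumes "tree_adj_eq w w'" "reduced_walk w" "reduced_walk w'"
  shows "tree_adj_eq (shrink w) (shrink w')"
  using assms by (cases rule: tree_adj_eq_cases) (auto simp: shrink_def tree_adj_eq_def)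

lemma tree_adj_eq_funpow_shrink:
  assumes "tree_adj_eq w w'" "reduced_walk w" "reduced_walk w'"
  shows "tree_adj_eq ((shrink ^^ i) w) ((shrink ^^ i) w')"
  using assms
  by (induction i) (auto simp: tree_adj_eq_shrink_shrink reduced_walk_funpow_shrink)

lemma funpow_shrink_singleton [simp]: "(shrink ^^ i) [v] = [v]"
  by (induction i) (auto simp: shrink_def)

text \<open>A list of length at most \<open>Suc i\<close> is at depth at most \<open>i\<close>, so
  \<open>i\<close> steps reach the root, where \<open>shrink\<close> stays.\<close>

lemma funpow_shrink_eq_last:
  assumes "w \<noteq> []" "length w \<le> Suc i"
  shows "(shrink ^^ i) w = [last w]"
  using assms
proof (induction i arbitrary: w)
  case 0
  then show ?case by (cases w) auto
next
  case (Suc i)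
  then show ?case
    by (cases w rule: reduced_walk.cases) (auto simp: shrink_def funpow_Suc_right simp del: funpow.simps)
qed

end

section \<open>Lattices and homotopies\<close>

lemma pverts_lattice_graph: "pverts (lattice_graph n) = PiE {1..n} (\<lambda>_. UNIV)"
  by (simp add: lattice_graph_def)

lemma upd_in_lattice:
  assumes "x \<in> pverts (lattice_graph n)" "i \<in> {1..n}"
  shows "x(i := c) \<in> pverts (lattice_graph n)"
  using assms by (auto simp: pverts_lattice_graph PiE_def extensional_def)

lemma lattice_arc_iff:
  "(x, y) \<in> parcs (lattice_graph n) \<longleftrightarrow> x \<in> pverts (lattice_graph n) \<and>
     (\<exists>i\<in>{1..n}. y = x(i := x i + 1) \<or> y = x(i := x i - 1))" (is "?L \<longleftrightarrow> ?R")
proof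
  assume ?L
  then obtain i where i: "x \<in> pverts (lattice_graph n)" "y \<in> pverts (lattice_graph n)"
    "i \<in> {1..n}" "\<bar>x i - y i\<bar> = 1" "\<forall>j\<in>{1..n} - {i}. x j = y j"
    by (auto simp: lattice_graph_def)
  \<comment> \<open>Off \<open>{1..n}\<close> both points are \<open>undefined\<close>, so they
    agree as functions everywhere except at \<open>i\<close>.\<close>
  then have "y = x(i := y i)"
    by (intro ext) (metis DiffI PiE_arb fun_upd_apply pverts_lattice_graph singletonD)
  moreover have "y i = x i + 1 \<or> y i = x i - 1" using i by linarith
  ultimately show ?R using i by metis
next
  assume R: ?R
  then obtain i where "i \<in> {1..n}" "y = x(i := x i + 1) \<or> y = x(i := x i - 1)" by blast
  moreover from this R have "y \<in> pverts (lattice_graph n)" by (metis upd_in_lattice)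
  ultimately have "y \<in> pverts (lattice_graph n)" "i \<in> {1..n}" "\<bar>x i - y i\<bar> = 1"
    "\<forall>j\<in>{1..n} - {i}. x j = y j"
    by (auto split: if_splits)
  with R show ?L by (auto simp: lattice_graph_def)
qed

text \<open>By symmetry of the arcs only upward steps have to be checked: a downward step is an
  upward one from its other end.\<close>

lemma (in pair_bidirected_digraph) graph_map_lattice_iff:
  "graph_map (lattice_graph n) G f \<longleftrightarrow>
     (\<forall>x \<in> pverts (lattice_graph n). f x \<in> pverts G \<and>
        (\<forall>i\<in>{1..n}. adj_or_eq G (f x) (f (x(i := x i + 1)))))" (is "?L \<longleftrightarrow> ?R")
proof
  assume L: ?L
  show ?R
  proof (intro ballI conjI)
    fix x i assume x: "x \<in> pverts (lattice_graph n)" and i: "i \<in> {1..n}"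
    then have "(x, x(i := x i + 1)) \<in> parcs (lattice_graph n)"
      by (auto simp: lattice_arc_iff)
    then show "adj_or_eq G (f x) (f (x(i := x i + 1)))"
      using L x upd_in_lattice[OF x i] by (auto simp: graph_map_def adj_or_eq_def)
  qed (use L in \<open>auto simp: graph_map_def\<close>)
next
  assume R: ?R
  have "adj_or_eq G (f x) (f y)"
    if xy: "x \<in> pverts (lattice_graph n)" "y \<in> pverts (lattice_graph n)"
      "(x, y) \<in> parcs (lattice_graph n)" for x y
  proof -
    obtain i where i: "i \<in> {1..n}" "y = x(i := x i + 1) \<or> y = x(i := x i - 1)"
      using xy(3) by (auto simp: lattice_arc_iff)
    from i(2) show ?thesis
    proof
      assume "y = x(i := x i - 1)"
      then have "x = y(i := y i + 1)" by auto
      with R xy(2) i(1) have "adj_or_eq G (f y) (f x)" by metis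
      then show ?thesis
        using pair_sym_arcs by (auto simp: adj_or_eq_def symmetric_def sym_def)
    qed (use R xy(1) i(1) in auto)
  qed
  with R show ?L by (auto simp: graph_map_def adj_or_eq_def)
qed

lemma based_mapsI:
  assumes "f \<in> extensional (pverts (lattice_graph n))" "graph_map (lattice_graph n) G f"
    and "\<And>x. x \<in> lattice_beyond n r \<Longrightarrow> f x = v0"
  shows "f \<in> based_maps n G v0"
  using assms unfolding based_maps_def by blast

lemma lattice_beyondI:
  "x \<in> pverts (lattice_graph n) \<Longrightarrow> i \<in> {1..n} \<Longrightarrow> \<bar>x i\<bar> \<ge> int r \<Longrightarrow> x \<in> lattice_beyond n r"
  by (auto simp: lattice_beyond_def)

lemma radius_beyond:
  assumes "f \<in> based_maps n G v0" "x \<in> lattice_beyond n (radius n v0 f)"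
  shows "f x = v0"
proof -
  have "\<exists>r. \<forall>x \<in> lattice_beyond n r. f x = v0" using assms(1) by (simp add: based_maps_def)
  from LeastI_ex[OF this] assms(2) show ?thesis unfolding radius_def by blast
qed

text \<open>A homotopy of length 1. An edge of the Cartesian product moves in one factor only, so
  comparing the two maps at the same point is enough.\<close>

definition homotopy_step ::
    "nat \<Rightarrow> 'a pair_pre_digraph \<Rightarrow> 'a \<Rightarrow> (((nat \<Rightarrow> int) \<Rightarrow> 'a) \<times> ((nat \<Rightarrow> int) \<Rightarrow> 'a)) set" where
  "homotopy_step n G v0 = {(f, g). f \<in> based_maps n G v0 \<and> g \<in> based_maps n G v0 \<and>
     (\<forall>x \<in> pverts (lattice_graph n). adj_or_eq G (f x) (g x))}"

lemma (in pair_bidirected_digraph) sym_homotopy_step: "sym (homotopy_step n G v0)"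
  using pair_sym_arcs by (auto simp: homotopy_step_def sym_def adj_or_eq_def symmetric_def)

text \<open>The maps of the chain become the layers of the homotopy. That \<open>f\<close> is based
  is assumed since the empty chain relates any function to itself.\<close>

lemma (in pair_bidirected_digraph) homotopy_steps_imp_homotopy:
  assumes "(f, g) \<in> (homotopy_step n G v0)\<^sup>*" "f \<in> based_maps n G v0"
  shows "(f, g) \<in> based_homotopy n G v0"
proof -
  obtain m where "(f, g) \<in> homotopy_step n G v0 ^^ m"
    using assms(1) rtrancl_imp_relpow by blast
  then obtain F where F: "F 0 = f" "F m = g"
    "\<And>i. i < m \<Longrightarrow> (F i, F (Suc i)) \<in> homotopy_step n G v0"
    by (auto simp: relpow_fun_conv)
  have based: "F i \<in> based_maps n G v0" if "i \<le> m" for i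
    using that F assms(2) by (cases i) (auto simp: homotopy_step_def Suc_le_eq)
  define h where "h = (\<lambda>(x, i). F (nat i) x)"
  have slice: "slice n h i = F (nat i)" if "i \<le> int m" for i
    using based[of "nat i"] that
    by (auto simp: slice_def h_def based_maps_def extensional_def restrict_def fun_eq_iff)
  have step: "adj_or_eq G (F i x) (F (Suc i) x)" "adj_or_eq G (F (Suc i) x) (F i x)"
    if "i < m" "x \<in> pverts (lattice_graph n)" for i x
    using F(3)[of i] that pair_sym_arcs
    by (auto simp: homotopy_step_def adj_or_eq_def symmetric_def sym_def)
  have "graph_map (cartesian_product (lattice_graph n) (interval_graph m)) G h"
    unfolding graph_map_def
  proof (intro conjI ballI impI)
    show "h \<in> pverts (cartesian_product (lattice_graph n) (interval_graph m)) \<rightarrow> pverts G"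
      using based
      by (auto simp: h_def cartesian_product_def interval_graph_def based_maps_def graph_map_def
          nat_le_iff Pi_iff)
    fix p q
    assume p: "p \<in> pverts (cartesian_product (lattice_graph n) (interval_graph m))"
      and q: "q \<in> pverts (cartesian_product (lattice_graph n) (interval_graph m))"
      and pq: "adj_or_eq (cartesian_product (lattice_graph n) (interval_graph m)) p q"
    obtain x i y j where xy: "p = (x, i)" "q = (y, j)" by fastforce
    have mem: "x \<in> pverts (lattice_graph n)" "y \<in> pverts (lattice_graph n)"
      "0 \<le> i" "i \<le> int m" "0 \<le> j" "j \<le> int m"
      using p q xy by (auto simp: cartesian_product_def interval_graph_def)
    \<comment> \<open>Within a layer the map \<open>F (nat i)\<close> is a graph map; between
      consecutive layers a homotopy step applies.\<close>
    consider "i = j" "adj_or_eq (lattice_graph n) x y"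
      | "x = y" "j = i + 1" | "x = y" "i = j + 1"
      using pq xy by (fastforce simp: adj_or_eq_def cartesian_product_def interval_graph_def int_graph_def)
    then show "adj_or_eq G (h p) (h q)"
    proof cases
      case 1
      then show ?thesis
        using based[of "nat i"] mem by (auto simp: h_def xy based_maps_def graph_map_def)
    next
      case 2
      then have "nat j = Suc (nat i)" "nat i < m" using mem by auto
      then show ?thesis using step(1)[of "nat i" x] 2 mem by (simp add: h_def xy)
    next
      case 3
      then have "nat i = Suc (nat j)" "nat j < m" using mem by auto
      then show ?thesis using step(2)[of "nat j" x] 3 mem by (simp add: h_def xy)
    qed
  qed
  moreover have "\<forall>i \<in> pverts (interval_graph m). slice n h i \<in> based_maps n G v0"
    using slice based by (auto simp: interval_graph_def)
  ultimately show ?thesis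
    using slice[of 0] slice[of "int m"] F(1,2) based[of 0] based[of m]
    unfolding based_homotopy_def by auto
qed

section \<open>The constant map and concatenations are based\<close>

lemma (in pair_bidirected_digraph) const_in_based_maps:
  assumes "v0 \<in> pverts G"
  shows "(\<lambda>x \<in> pverts (lattice_graph n). v0) \<in> based_maps n G v0"
  using assms
  by (intro based_mapsI[where r = 0])
    (auto simp: graph_map_lattice_iff upd_in_lattice adj_or_eq_def lattice_beyond_def)

lemma (in pair_bidirected_digraph) map_concat_in_based_maps:
  assumes f: "f \<in> based_maps n G v0" and g: "g \<in> based_maps n G v0" and n: "n \<ge> 1"
  shows "map_concat n v0 f g \<in> based_maps n G v0"
proof -
  define r s where "r = radius n v0 f" and "s = radius n v0 g"
  define c where "c = int r + int s"
  define p where "p = map_concat n v0 f g"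
  have f_beyond: "f x = v0" if "x \<in> pverts (lattice_graph n)" "i \<in> {1..n}" "\<bar>x i\<bar> \<ge> int r" for x i
    using radius_beyond[OF f] lattice_beyondI[OF that] by (simp add: r_def)
  have g_beyond: "g x = v0" if "x \<in> pverts (lattice_graph n)" "i \<in> {1..n}" "\<bar>x i\<bar> \<ge> int s" for x i
    using radius_beyond[OF g] lattice_beyondI[OF that] by (simp add: s_def)
  have f_map: "f x \<in> pverts G" "i \<in> {1..n} \<Longrightarrow> adj_or_eq G (f x) (f (x(i := x i + 1)))"
    if "x \<in> pverts (lattice_graph n)" for x i
    using f that by (auto simp: based_maps_def graph_map_lattice_iff)
  have g_map: "g x \<in> pverts G" "i \<in> {1..n} \<Longrightarrow> adj_or_eq G (g x) (g (x(i := x i + 1)))"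
    if "x \<in> pverts (lattice_graph n)" for x i
    using g that by (auto simp: based_maps_def graph_map_lattice_iff)
  have p_eq: "p x = (if x 1 \<le> int r then f x else g (x(1 := x 1 - c)))"
    if "x \<in> pverts (lattice_graph n)" for x
    using that by (simp add: p_def map_concat_def r_def s_def c_def)
  have one: "1 \<in> {1..n}" using n by simp
  have "graph_map (lattice_graph n) G p"
    unfolding graph_map_lattice_iff
  proof (intro ballI conjI)
    fix x assume x: "x \<in> pverts (lattice_graph n)"
    note shift = upd_in_lattice[OF x one]
    show "p x \<in> pverts G" using f_map(1)[OF x] g_map(1)[OF shift] by (simp add: p_eq[OF x])
    fix i assume i: "i \<in> {1..n}"
    note px = p_eq[OF x] and py = p_eq[OF upd_in_lattice[OF x i], of "x i + 1"]
    consider "i \<noteq> 1" | "i = 1" "x 1 < int r" | "i = 1" "x 1 = int r" | "i = 1" "x 1 > int r"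
      by linarith
    then show "adj_or_eq G (p x) (p (x(i := x i + 1)))"
    proof cases
      case 1
      then show ?thesis
        using f_map(2)[OF x i] g_map(2)[OF shift i, of "x 1 - c"] by (simp add: px py fun_upd_twist)
    next
      case 2
      then show ?thesis using f_map(2)[OF x i] px py by simp
    next
      case 3
      \<comment> \<open>At the seam \<open>f x = v0\<close>, while the next point has the value of
        \<open>g\<close> at first coordinate \<open>1 - s\<close>. It is adjacent or equal to the
        value at \<open>- s\<close>, which is \<open>v0\<close> too.\<close>
      have "g (x(1 := - int s)) = v0"
        using g_beyond[OF shift one] by simp
      with 3 show ?thesis
        using f_beyond[OF x one] g_map(2)[OF shift one, of "- int s"]
          px py by (simp add: c_def)
    next
      case 4
      then show ?thesis
        using g_map(2)[OF shift one, of "x 1 - c"] px py by (simp add: algebra_simps)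
    qed
  qed
  \<comment> \<open>The copy of \<open>g\<close> is centred at first coordinate
    \<open>c = r + s\<close> and takes values other than \<open>v0\<close> only below
    \<open>c + s\<close>.\<close>
  moreover have "p x = v0" if x_beyond: "x \<in> lattice_beyond n (r + 2 * s + 1)" for x
  proof -
    obtain i where x: "x \<in> pverts (lattice_graph n)" and i: "i \<in> {1..n}"
      "\<bar>x i\<bar> \<ge> int (r + 2 * s + 1)"
      using x_beyond by (auto simp: lattice_beyond_def)
    have "g (x(1 := x 1 - c)) = v0" if "x 1 > int r"
      using g_beyond[OF upd_in_lattice[OF x one] i(1), of "x 1 - c"] i that
      by (cases "i = 1") (auto simp: c_def)
    then show ?thesis using f_beyond[OF x i(1)] i by (simp add: p_eq[OF x])
  qed
  moreover have "p \<in> extensional (pverts (lattice_graph n))"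
    by (simp add: p_def map_concat_def)
  ultimately show ?thesis unfolding p_def by (blast intro: based_mapsI)
qed

section \<open>Lifting based maps\<close>

context no_short_cycles
begin

context
  fixes n :: nat and v0 :: 'a and f :: "(nat \<Rightarrow> int) \<Rightarrow> 'a" and r :: nat
  assumes n: "n \<ge> 2"
    and f: "f \<in> based_maps n G v0"
    and beyond: "\<And>x. x \<in> lattice_beyond n r \<Longrightarrow> f x = v0"
begin

text \<open>The value of \<open>x\<close> at \<open>1\<close> is irrelevant here: the line through \<open>x\<close> in the first direction is
  followed from \<open>- r\<close> on.\<close>

primrec line_lift :: "(nat \<Rightarrow> int) \<Rightarrow> nat \<Rightarrow> 'a list" where
  "line_lift x 0 = [f (x(1 := - int r))]"
| "line_lift x (Suc k) = extend (line_lift x k) (f (x(1 := int (Suc k) - int r)))"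

text \<open>For \<open>x 1 \<le> - r\<close> the function \<open>nat\<close> returns 0, so the lift
  there is the starting walk \<open>[v0]\<close>.\<close>

definition lift :: "(nat \<Rightarrow> int) \<Rightarrow> 'a list" where
  "lift x = line_lift x (nat (x 1 + int r))"

lemma one_two: "1 \<in> {1..n}" "2 \<in> {1..n}"
  using n by auto

lemma f_map:
  assumes "x \<in> pverts (lattice_graph n)"
  shows "f x \<in> pverts G" and "i \<in> {1..n} \<Longrightarrow> f x \<simeq> f (x(i := x i + 1))"
  using f assms by (auto simp: based_maps_def graph_map_lattice_iff)

lemma f_beyond: "x \<in> pverts (lattice_graph n) \<Longrightarrow> i \<in> {1..n} \<Longrightarrow> \<bar>x i\<bar> \<ge> int r \<Longrightarrow> f x = v0"
  by (intro beyond lattice_beyondI)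

lemma hd_line_lift: "hd (line_lift x k) = f (x(1 := int k - int r))"
  by (cases k) auto

lemma line_lift_upd: "line_lift (x(1 := c)) k = line_lift x k"
  by (induction k) (simp_all only: line_lift.simps fun_upd_upd)

lemma f_line_adj:
  assumes "x \<in> pverts (lattice_graph n)"
  shows "f (x(1 := int k - int r)) \<simeq> f (x(1 := int (Suc k) - int r))"
  using f_map(2)[OF upd_in_lattice[OF assms one_two(1)] one_two(1), of "int k - int r"]
  by (simp add: algebra_simps)

lemma reduced_walk_line_lift:
  assumes "x \<in> pverts (lattice_graph n)"
  shows "reduced_walk (line_lift x k)"
proof (induction k)
  case 0
  then show ?case using f_map(1) upd_in_lattice[OF assms one_two(1)] by simp
next
  case (Suc k)
  then show ?case
    using f_line_adj[OF assms, of k] by (auto intro!: reduced_walk_extend simp: hd_line_lift)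
qed

text \<open>Neighbouring parallel lines both start from \<open>[v0]\<close> and are then extended in
  parallel, so adjacency is carried along square by square.\<close>

lemma line_lift_adj:
  assumes x: "x \<in> pverts (lattice_graph n)" and i: "i \<in> {1..n}" "i \<noteq> 1"
  shows "tree_adj_eq (line_lift x k) (line_lift (x(i := x i + 1)) k)"
proof (induction k)
  case 0
  have "f (x(1 := - int r)) = v0" "f (x(i := x i + 1, 1 := - int r)) = v0"
    using x i one_two by (auto intro!: f_beyond[where i = 1] upd_in_lattice)
  then show ?case by (simp only: line_lift.simps tree_adj_eq_refl)
next
  case (Suc k)
  define y where "y = x(i := x i + 1)"
  have y: "y \<in> pverts (lattice_graph n)" unfolding y_def using x i(1) by (rule upd_in_lattice)
  have "f (x(1 := c)) \<simeq> f (y(1 := c))" for c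
    using f_map(2)[OF upd_in_lattice[OF x one_two(1)] i(1), of c] i(2)
    by (simp add: y_def fun_upd_twist)
  then show ?case
    using Suc f_line_adj[OF x, of k] f_line_adj[OF y, of k] x y unfolding y_def[symmetric]
    by (auto intro!: tree_adj_eq_extend_extend simp: hd_line_lift reduced_walk_line_lift)
qed

lemma line_lift_eq_if_const:
  assumes "\<And>c. f (x(1 := c)) = v0"
  shows "line_lift x k = [v0]"
  using assms by (induction k) (auto simp: extend_def)

lemma lift_low:
  assumes "x \<in> pverts (lattice_graph n)" "x 1 \<le> - int r"
  shows "lift x = [v0]"
  using assms f_beyond[OF upd_in_lattice[OF assms(1) one_two(1)] one_two(1)] by (simp add: lift_def)

lemma hd_lift:
  assumes "x \<in> pverts (lattice_graph n)"
  shows "hd (lift x) = f x"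
proof (cases "x 1 \<le> - int r")
  case True
  then show ?thesis using lift_low[OF assms] f_beyond[OF assms one_two(1)] by simp
next
  case False
  then show ?thesis by (simp add: lift_def hd_line_lift)
qed

lemma reduced_walk_lift: "x \<in> pverts (lattice_graph n) \<Longrightarrow> reduced_walk (lift x)"
  by (simp add: lift_def reduced_walk_line_lift)

lemma lift_adj:
  assumes x: "x \<in> pverts (lattice_graph n)" and i: "i \<in> {1..n}"
  shows "tree_adj_eq (lift x) (lift (x(i := x i + 1)))"
proof (cases "i = 1")
  case False
  then show ?thesis using line_lift_adj[OF x i] by (simp add: lift_def)
next
  case True
  show ?thesis
  \<comment> \<open>Strictly left of \<open>- r\<close> both points still have the lift
    \<open>[v0]\<close>; from \<open>- r\<close> on, a step is one application of
    \<open>extend\<close>.\<close>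
  proof (cases "x 1 < - int r")
    case low: True
    then show ?thesis
      using True lift_low[OF x] lift_low[OF upd_in_lattice[OF x i], of "x i + 1"] by simp
  next
    case False
    then have "nat (x 1 + 1 + int r) = Suc (nat (x 1 + int r))" by simp
    then have "lift (x(1 := x 1 + 1)) = extend (lift x) (f (x(1 := x 1 + 1)))"
      using False by (simp add: lift_def line_lift_upd add.commute del: One_nat_def)
    then show ?thesis using True tree_adj_eq_extend by simp
  qed
qed

text \<open>The large coordinate is not the first, so the whole line in the first direction lies
  where \<open>f\<close> is \<open>v0\<close>.\<close>

lemma lift_beyond_2:
  assumes "x \<in> pverts (lattice_graph n)" "i \<in> {1..n}" "i \<noteq> 1" "\<bar>x i\<bar> \<ge> int r"
  shows "lift x = [v0]"
  unfolding lift_def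
  using assms f_beyond[OF upd_in_lattice[OF assms(1) one_two(1)] assms(2)]
  by (intro line_lift_eq_if_const) auto

text \<open>Walking in the second direction stays in the region where \<open>f\<close> is constant, hence does not
  change the lift, and ends where the whole line was constant.\<close>

lemma lift_high:
  assumes x: "x \<in> pverts (lattice_graph n)" and high: "x 1 \<ge> int r"
  shows "lift x = [v0]"
proof -
  have in_lattice: "x(2 := c) \<in> pverts (lattice_graph n)" for c
    using x one_two(2) by (rule upd_in_lattice)
  have "lift (x(2 := x 2 + int t)) = lift x" for t
  proof (induction t)
    case (Suc t)
    let ?y = "x(2 := x 2 + int t)"
    have eq: "?y(2 := ?y 2 + 1) = x(2 := x 2 + int (Suc t))" by (simp add: algebra_simps)
    have "f (x(2 := c)) = v0" for c
      using f_beyond[OF in_lattice one_two(1)] high by simp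
    then have "hd (lift (x(2 := c))) = v0" for c using hd_lift[OF in_lattice] by simp
    \<comment> \<open>The two lifts are adjacent or equal and both end in \<open>v0\<close>, hence
      they coincide.\<close>
    then have "lift ?y = lift (x(2 := x 2 + int (Suc t)))"
      using lift_adj[OF in_lattice one_two(2), of "x 2 + int t"]
      by (intro tree_adj_eq_same_hd reduced_walk_lift in_lattice) (simp_all only: eq)
    with Suc show ?case by (simp only:)
  qed simp
  \<comment> \<open>Adding \<open>\<bar>x 2\<bar> + r\<close> makes the second coordinate at least
    \<open>r\<close>.\<close>
  moreover have "lift (x(2 := x 2 + int (nat \<bar>x 2\<bar> + r))) = [v0]"
    using one_two(2) by (intro lift_beyond_2[where i = 2] in_lattice) auto
  ultimately show ?thesis by metis
qed

lemma lift_beyond: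
  assumes "x \<in> lattice_beyond n r"
  shows "lift x = [v0]"
proof -
  obtain i where x: "x \<in> pverts (lattice_graph n)" and i: "i \<in> {1..n}" "\<bar>x i\<bar> \<ge> int r"
    using assms by (auto simp: lattice_beyond_def)
  show ?thesis
  proof (cases "i = 1")
    case True
    with i(2) consider "x 1 \<le> - int r" | "x 1 \<ge> int r" by fastforce
    then show ?thesis using lift_low[OF x] lift_high[OF x] by cases auto
  qed (use lift_beyond_2[OF x i(1)] i in auto)
qed

lemma last_line_lift:
  assumes "x \<in> pverts (lattice_graph n)"
  shows "last (line_lift x k) = v0"
proof (induction k)
  case 0
  then show ?case using f_beyond[OF upd_in_lattice[OF assms one_two(1)] one_two(1)] by simp
next
  case (Suc k)
  then show ?case
    using reduced_walk_not_Nil[OF reduced_walk_line_lift[OF assms, of k]] by (simp add: last_extend)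
qed

lemma length_line_lift: "length (line_lift x k) \<le> Suc k"
  by (induction k) (auto intro: order_trans[OF length_extend])

text \<open>Past \<open>r\<close> the lift is \<open>[v0]\<close> again, so only the steps between
  \<open>- r\<close> and \<open>r\<close> count. This uniform bound makes the contraction end after
  finitely many steps.\<close>

lemma length_lift:
  assumes x: "x \<in> pverts (lattice_graph n)"
  shows "length (lift x) \<le> Suc (2 * r)"
proof (cases "x 1 \<ge> int r")
  case True
  then show ?thesis using lift_high[OF x] by simp
next
  case False
  then show ?thesis
    using length_line_lift[of x "nat (x 1 + int r)"] by (simp add: lift_def)
qed

section \<open>The contracting homotopy\<close>

definition contraction :: "nat \<Rightarrow> (nat \<Rightarrow> int) \<Rightarrow> 'a" where
  "contraction i = (\<lambda>x \<in> pverts (lattice_graph n). hd ((shrink ^^ i) (lift x)))"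

text \<open>The radius \<open>r\<close> serves all stages: beyond it the lift is the root
  \<open>[v0]\<close>, which \<open>shrink\<close> fixes.\<close>

lemma contraction_based: "contraction i \<in> based_maps n G v0"
proof (rule based_mapsI[where r = r])
  show "graph_map (lattice_graph n) G (contraction i)"
    unfolding graph_map_lattice_iff
    by (auto simp: contraction_def upd_in_lattice
        intro!: tree_adj_eq_hd tree_adj_eq_funpow_shrink reduced_walk_funpow_shrink reduced_walk_hd
          reduced_walk_lift lift_adj)
qed (auto simp: contraction_def lift_beyond lattice_beyond_def)

lemma contraction_step: "(contraction i, contraction (Suc i)) \<in> homotopy_step n G v0"
  using contraction_based[of i] contraction_based[of "Suc i"]
  by (auto simp: homotopy_step_def contraction_def reduced_walk_lift
      intro!: tree_adj_eq_hd tree_adj_eq_shrink reduced_walk_shrink reduced_walk_funpow_shrink)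

lemma contraction_0: "contraction 0 = f"
  using f by (auto simp: contraction_def hd_lift based_maps_def extensional_def fun_eq_iff)

lemma contraction_end: "contraction (2 * r) = (\<lambda>x \<in> pverts (lattice_graph n). v0)"
  unfolding contraction_def
proof (rule restrict_ext)
  fix x assume x: "x \<in> pverts (lattice_graph n)"
  \<comment> \<open>The lift at \<open>x\<close> has at most \<open>2 * r\<close> edges, and its
    root is its start vertex \<open>v0\<close>.\<close>
  have "(shrink ^^ (2 * r)) (lift x) = [last (lift x)]"
    using reduced_walk_not_Nil[OF reduced_walk_lift[OF x]] length_lift[OF x]
    by (rule funpow_shrink_eq_last)
  then show "hd ((shrink ^^ (2 * r)) (lift x)) = v0"
    using last_line_lift[OF x] by (simp add: lift_def)
qed

lemma null_homotopic_aux: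
  "(f, \<lambda>x \<in> pverts (lattice_graph n). v0) \<in> (homotopy_step n G v0)\<^sup>*"
proof -
  have "(contraction 0, contraction i) \<in> (homotopy_step n G v0)\<^sup>*" for i
    by (induction i) (auto intro: rtrancl_into_rtrancl contraction_step)
  from this[of "2 * r"] show ?thesis by (simp only: contraction_0 contraction_end)
qed

end

section \<open>Triviality of the homotopy group\<close>

lemma based_map_null_homotopic:
  assumes "n \<ge> 2" "f \<in> based_maps n G v0"
  shows "(f, \<lambda>x \<in> pverts (lattice_graph n). v0) \<in> (homotopy_step n G v0)\<^sup>*"
  using assms radius_beyond[OF assms(2)] by (rule null_homotopic_aux)

lemma based_homotopy_eq:
  assumes "n \<ge> 2"
  shows "based_homotopy n G v0 = based_maps n G v0 \<times> based_maps n G v0"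
proof
  show "based_homotopy n G v0 \<subseteq> based_maps n G v0 \<times> based_maps n G v0"
    by (auto simp: based_homotopy_def)
  show "based_maps n G v0 \<times> based_maps n G v0 \<subseteq> based_homotopy n G v0"
  proof clarify
    fix f g assume fg: "f \<in> based_maps n G v0" "g \<in> based_maps n G v0"
    \<comment> \<open>The contraction of \<open>g\<close> run backwards; \<open>f\<close> and
      \<open>g\<close> are joined through the constant map.\<close>
    have "(\<lambda>x \<in> pverts (lattice_graph n). v0, g) \<in> (homotopy_step n G v0)\<^sup>*"
      using based_map_null_homotopic[OF assms fg(2)] sym_rtrancl[OF sym_homotopy_step]
      by (meson symD)
    with based_map_null_homotopic[OF assms fg(1)] show "(f, g) \<in> based_homotopy n G v0"
      by (intro homotopy_steps_imp_homotopy[OF _ fg(1)]) (rule rtrancl_trans)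
  qed
qed

lemma trivial_discrete_homotopy_group:
  assumes "n \<ge> 2" "v0 \<in> pverts G"
  shows "trivial_group (discrete_homotopy_group n G v0)"
proof -
  let ?B = "based_maps n G v0"
  have class_eq: "based_homotopy n G v0 `` {f} = ?B" if "f \<in> ?B" for f
    using that by (auto simp: based_homotopy_eq[OF assms(1)])
  have const: "(\<lambda>x \<in> pverts (lattice_graph n). v0) \<in> ?B"
    using assms(2) by (rule const_in_based_maps)
  have carrier: "carrier (discrete_homotopy_group n G v0) = {?B}"
    using const class_eq by (auto simp: discrete_homotopy_group_def quotient_def)
  have one: "\<one>\<^bsub>discrete_homotopy_group n G v0\<^esub> = ?B"
    using class_eq[OF const] by (simp add: discrete_homotopy_group_def)
  \<comment> \<open>Every concatenation is based, so each class in the union is \<open>?B\<close>;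
    the constant map makes the union nonempty.\<close>
  have mult: "?B \<otimes>\<^bsub>discrete_homotopy_group n G v0\<^esub> ?B = ?B"
    using const class_eq map_concat_in_based_maps assms(1)
    by (auto simp: discrete_homotopy_group_def)
  have "group (discrete_homotopy_group n G v0)"
    by (rule groupI) (auto simp: carrier one mult)
  then show ?thesis by (simp add: trivial_group_def carrier one)
qed

end

theorem theorem1p1:
  fixes G :: "'a pair_pre_digraph" and v0 :: 'a and n :: nat
  assumes "pair_bidirected_digraph G"
    and "connected (with_proj G)"
    and "\<not> (\<exists>p. pre_digraph.cycle (with_proj G) p \<and> length p = 3)"
    and "\<not> (\<exists>p. pre_digraph.cycle (with_proj G) p \<and> length p = 4)"
    and "v0 \<in> pverts G"
    and "n \<ge> 2"
  shows "trivial_group (discrete_homotopy_group n G v0)"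
proof -
  interpret no_short_cycles G
    using assms(1,3,4) by (simp add: no_short_cycles_def no_short_cycles_axioms_def)
  show ?thesis using assms(6,5) by (rule trivial_discrete_homotopy_group)
qed

end
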